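(* Let $a,b>0$, $\nu\in [0,1]$ and $N\in \mathbb{N}$ with $N\geq 2$. Then $$\left(a^{\nu}b^{1-\nu}\right)^2+s_1(\nu)^2(a-b)^2+\sum_{j=2}^{N}s_j(\nu)\left(\sqrt[2^{j-1}]{b^{2^{j-1}-k_j(\nu)}a^{k_j(\nu)}}-\sqrt[2^{j-1}]{a^{k_j(\nu)+1}b^{2^{j-1}-k_j(\nu)-1}}\right)^2\leq \left(\nu a+(1-\nu)b\right)^2.$$
   Context: $[x]$ denotes the greatest integer $\le x$. For $\nu\in[0,1]$ and $j\geq 1$ put $k_j(\nu)=[2^{j-1}\nu]$, $r_j(\nu)=[2^{j}\nu]$ and $s_j(\nu)=(-1)^{r_j(\nu)}2^{j-1}\nu+(-1)^{r_j(\nu)+1}\left[\frac{r_j(\nu)+1}{2}\right]$. *)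

theory Defs
  imports Complex_Main
begin

(* Integer-valued because exponents built from it can be negative: for \<nu> = 1 we have
   k_idx j \<nu> = 2 ^ (j - 1), so the exponent 2 ^ (j - 1) - k_idx j \<nu> - 1 is -1. *)
definition k_idx :: "nat \<Rightarrow> real \<Rightarrow> int" where
  "k_idx j \<nu> = \<lfloor>2 ^ (j - 1) * \<nu>\<rfloor>"

definition r_idx :: "nat \<Rightarrow> real \<Rightarrow> int" where
  "r_idx j \<nu> = \<lfloor>2 ^ j * \<nu>\<rfloor>"

definition s_coeff :: "nat \<Rightarrow> real \<Rightarrow> real" where
  "s_coeff j \<nu> =
     (- 1) powi (r_idx j \<nu>) * 2 ^ (j - 1) * \<nu>
     + (- 1) powi (r_idx j \<nu> + 1) * of_int \<lfloor>(of_int (r_idx j \<nu>) + 1) / (2 :: real)\<rfloor>"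

end

theory Submission
  imports Defs
begin

text \<open>
  Let \<open>g t = a\<^sup>t b\<^sup>1\<^sup>-\<^sup>t\<close> and let \<open>L\<^sub>n\<close> be the piecewise linear interpolation of \<open>g\<^sup>2\<close> at the
  dyadic points \<open>k / 2\<^sup>n\<close>. Since the value of \<open>g\<^sup>2\<close> at the midpoint of \<open>s\<close> and \<open>t\<close> is
  \<open>g s * g t\<close>, halving the mesh lowers the interpolation at a midpoint by
  \<open>(g s - g t)\<^sup>2 / 2\<close>; as \<open>s\<^sub>j(\<nu>)\<close> is the distance from \<open>2\<^sup>j\<^sup>-\<^sup>1 \<nu>\<close> to the nearest integer, the
  \<open>j\<close>-th summand is exactly \<open>L\<^sub>j\<^sub>-\<^sub>1(\<nu>) - L\<^sub>j(\<nu>)\<close>. The sum telescopes, and \<open>L\<^sub>N \<ge> g\<^sup>2\<close> because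
  \<open>g\<^sup>2\<close> is convex. Finally \<open>s\<^sub>1(1 - s\<^sub>1) = \<nu>(1 - \<nu>)\<close> turns \<open>L\<^sub>0(\<nu>) - s\<^sub>1(a - b)\<^sup>2\<close> into
  \<open>(\<nu> a + (1 - \<nu>) b)\<^sup>2 - s\<^sub>1\<^sup>2(a - b)\<^sup>2\<close>.
\<close>

definition geo_mean :: "real \<Rightarrow> real \<Rightarrow> real \<Rightarrow> real" where
  "geo_mean a b t = a powr t * b powr (1 - t)"

text \<open>At a dyadic point the right node has weight 0; this covers \<open>\<nu> = 1\<close>,
  where that node lies beyond 1.\<close>

definition dyadic_interp :: "(real \<Rightarrow> real) \<Rightarrow> nat \<Rightarrow> real \<Rightarrow> real" where
  "dyadic_interp f n \<nu> =
     (1 - frac (2 ^ n * \<nu>)) * f (of_int \<lfloor>2 ^ n * \<nu>\<rfloor> / 2 ^ n)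
     + frac (2 ^ n * \<nu>) * f ((of_int \<lfloor>2 ^ n * \<nu>\<rfloor> + 1) / 2 ^ n)"

lemma floor_frac_double:
  fixes x :: real
  shows "frac x < 1/2 \<Longrightarrow> \<lfloor>2 * x\<rfloor> = 2 * \<lfloor>x\<rfloor> \<and> frac (2 * x) = 2 * frac x"
    and "frac x \<ge> 1/2 \<Longrightarrow> \<lfloor>2 * x\<rfloor> = 2 * \<lfloor>x\<rfloor> + 1 \<and> frac (2 * x) = 2 * frac x - 1"
proof -
  show "\<lfloor>2 * x\<rfloor> = 2 * \<lfloor>x\<rfloor> \<and> frac (2 * x) = 2 * frac x" if "frac x < 1/2"
  proof -
    have "\<lfloor>2 * x\<rfloor> = 2 * \<lfloor>x\<rfloor>"
      using that by (intro floor_unique; simp add: frac_def; linarith)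
    then show ?thesis by (simp add: frac_def)
  qed
  show "\<lfloor>2 * x\<rfloor> = 2 * \<lfloor>x\<rfloor> + 1 \<and> frac (2 * x) = 2 * frac x - 1" if "frac x \<ge> 1/2"
  proof -
    have "\<lfloor>2 * x\<rfloor> = 2 * \<lfloor>x\<rfloor> + 1"
      using that by (intro floor_unique; simp add: frac_def; linarith)
    then show ?thesis by (simp add: frac_def)
  qed
qed

text \<open>With \<open>x = 2 ^ n * \<nu>\<close>, the parity of
  \<open>\<lfloor>2 * x\<rfloor>\<close> tells which half of its unit interval contains
  \<open>x\<close>. If even, the sign is + and the rounded half is
  \<open>\<lfloor>x\<rfloor>\<close>; if odd, the sign is - and it is
  \<open>\<lfloor>x\<rfloor> + 1\<close>.\<close>

lemma s_coeff_Suc: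
  "s_coeff (Suc n) \<nu> = min (frac (2 ^ n * \<nu>)) (1 - frac (2 ^ n * \<nu>))"
proof -
  define x where "x = 2 ^ n * \<nu>"
  have s: "s_coeff (Suc n) \<nu> = (- 1) powi \<lfloor>2 * x\<rfloor> * x
      + (- 1) powi (\<lfloor>2 * x\<rfloor> + 1) * of_int \<lfloor>(of_int \<lfloor>2 * x\<rfloor> + 1) / (2 :: real)\<rfloor>"
    by (simp add: s_coeff_def r_idx_def x_def mult.assoc)
  show ?thesis
  proof (cases "frac x < 1/2")
    case True
    have "\<lfloor>(2 * real_of_int \<lfloor>x\<rfloor> + 1) / 2\<rfloor> = \<lfloor>x\<rfloor>"
      by (rule floor_unique) auto
    with True floor_frac_double(1)[OF True] show ?thesis
      unfolding s by (simp add: power_int_minus_left x_def[symmetric] frac_def)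
  next
    case False
    have "\<lfloor>(2 * real_of_int \<lfloor>x\<rfloor> + 1 + 1) / 2\<rfloor> = \<lfloor>x\<rfloor> + 1"
      by (rule floor_unique) auto
    with False floor_frac_double(2)[of x] show ?thesis
      unfolding s by (simp add: power_int_minus_left x_def[symmetric] frac_def)
  qed
qed

context
  fixes a b :: real
  assumes a: "a > 0" and b: "b > 0"
begin

lemma geo_mean_exp: "geo_mean a b t = exp (t * ln a + (1 - t) * ln b)"
  using a b by (simp add: geo_mean_def powr_def exp_add)

lemma geo_mean_midpoint: "(geo_mean a b ((s + t) / 2))\<^sup>2 = geo_mean a b s * geo_mean a b t"
  unfolding geo_mean_exp power2_eq_square mult_exp_exp by (simp add: field_simps)

text \<open>Both roots in a summand are values of \<open>geo_mean\<close> at adjacent dyadic nodes: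
  take \<open>k\<close> and then \<open>k + 1\<close>, with \<open>m = 2 ^ n\<close>. Integer
  exponents allow \<open>l = -1\<close>, which occurs at \<open>\<nu> = 1\<close>.\<close>

lemma root_powi_eq_geo_mean:
  assumes "m > 0" and "l = int m - k"
  shows "root m (b powi l * a powi k) = geo_mean a b (of_int k / real m)"
proof (rule real_root_pos_unique)
  have "geo_mean a b (of_int k / real m) ^ m = exp (of_int k * ln a + of_int l * ln b)"
    using assms by (simp add: geo_mean_exp exp_of_nat_mult[symmetric] distrib_left right_diff_distrib
        left_diff_distrib)
  also have "\<dots> = b powi l * a powi k"
    using powr_real_of_int'[of a k] powr_real_of_int'[of b l] a b by (simp add: exp_add powr_def)
  finally show "geo_mean a b (of_int k / real m) ^ m = b powi l * a powi k" .
qed (use assms in \<open>simp_all add: geo_mean_exp\<close>)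

lemma dyadic_interp_geo_mean_Suc:
  "dyadic_interp (\<lambda>t. (geo_mean a b t)\<^sup>2) n \<nu> =
     dyadic_interp (\<lambda>t. (geo_mean a b t)\<^sup>2) (Suc n) \<nu>
     + s_coeff (Suc n) \<nu> * (geo_mean a b (of_int \<lfloor>2 ^ n * \<nu>\<rfloor> / 2 ^ n)
                           - geo_mean a b ((of_int \<lfloor>2 ^ n * \<nu>\<rfloor> + 1) / 2 ^ n))\<^sup>2"
proof -
  define x k where "x = 2 ^ n * \<nu>" and "k = real_of_int \<lfloor>x\<rfloor>"
  define g where "g = geo_mean a b"
  have x2: "2 ^ Suc n * \<nu> = 2 * x" by (simp add: x_def)
  have mid: "(g ((2 * k + 1) / 2 ^ Suc n))\<^sup>2 = g (k / 2 ^ n) * g ((k + 1) / 2 ^ n)"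
    unfolding g_def geo_mean_midpoint[symmetric] by (simp add: field_simps)
  have l: "g (2 * k / 2 ^ Suc n) = g (k / 2 ^ n)"
    and r: "g ((2 * k + 1 + 1) / 2 ^ Suc n) = g ((k + 1) / 2 ^ n)"
    by (simp_all add: add_divide_distrib add.assoc)
  show ?thesis
  \<comment> \<open>The finer cell containing \<open>\<nu>\<close> is the left or the right half of
    the coarse one, so its nodes are the midpoint and one old endpoint.\<close>
  proof (cases "frac x < 1/2")
    case True
    then have s: "s_coeff (Suc n) \<nu> = frac x" by (simp add: s_coeff_Suc x_def)
    have f: "real_of_int \<lfloor>2 * x\<rfloor> = 2 * k" "frac (2 * x) = 2 * frac x"
      using floor_frac_double(1)[OF True] by (simp_all add: k_def)
    show ?thesis
      unfolding dyadic_interp_def x2 s f g_def[symmetric] x_def[symmetric] k_def[symmetric] mid l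
      by (simp add: power2_eq_square algebra_simps)
  next
    case False
    then have s: "s_coeff (Suc n) \<nu> = 1 - frac x" by (simp add: s_coeff_Suc x_def)
    have f: "real_of_int \<lfloor>2 * x\<rfloor> = 2 * k + 1" "frac (2 * x) = 2 * frac x - 1"
      using floor_frac_double(2)[of x] False by (simp_all add: k_def)
    show ?thesis
      unfolding dyadic_interp_def x2 s f g_def[symmetric] x_def[symmetric] k_def[symmetric] mid r
      by (simp add: power2_eq_square algebra_simps)
  qed
qed

lemma geo_mean_le_dyadic_interp:
  "(geo_mean a b \<nu>)\<^sup>2 \<le> dyadic_interp (\<lambda>t. (geo_mean a b t)\<^sup>2) n \<nu>"
proof -
  define x where "x = 2 ^ n * \<nu>"
  define c where "c = 2 * (ln a - ln b)"
  define G where "G t = (geo_mean a b t)\<^sup>2" for t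
  define t0 t1 where "t0 = real_of_int \<lfloor>x\<rfloor> / 2 ^ n" and "t1 = (real_of_int \<lfloor>x\<rfloor> + 1) / 2 ^ n"
  \<comment> \<open>\<open>G\<close> is exponential with logarithmic derivative \<open>c\<close>, so
    \<open>1 + u \<le> exp u\<close> puts it above its tangent at \<open>\<nu>\<close>. Averaging
    over \<open>t0\<close> and \<open>t1\<close>, whose weighted mean is \<open>\<nu>\<close>,
    cancels the linear term.\<close>
  have tangent: "G \<nu> * (1 + c * (t - \<nu>)) \<le> G t" for t
  proof -
    have "G t = G \<nu> * exp (c * (t - \<nu>))"
      unfolding G_def c_def geo_mean_exp power2_eq_square mult_exp_exp by (simp add: algebra_simps)
    then show ?thesis
      by (simp add: G_def mult_left_mono)
  qed
  have "(1 - frac x) * t0 + frac x * t1 = \<nu>"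
    by (simp add: t0_def t1_def frac_def x_def field_simps)
  then have "G \<nu> = G \<nu> * (1 + c * ((1 - frac x) * t0 + frac x * t1 - \<nu>))"
    by simp
  also have "\<dots> = (1 - frac x) * (G \<nu> * (1 + c * (t0 - \<nu>))) + frac x * (G \<nu> * (1 + c * (t1 - \<nu>)))"
    by (simp add: algebra_simps)
  also have "\<dots> \<le> (1 - frac x) * G t0 + frac x * G t1"
    using frac_lt_1[of x] by (intro add_mono mult_left_mono tangent) auto
  finally show ?thesis
    by (simp add: dyadic_interp_def G_def t0_def t1_def x_def)
qed

lemma dyadic_interp_geo_mean_telescope:
  "dyadic_interp (\<lambda>t. (geo_mean a b t)\<^sup>2) 0 \<nu> =
     dyadic_interp (\<lambda>t. (geo_mean a b t)\<^sup>2) N \<nu>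
     + (\<Sum>n<N. s_coeff (Suc n) \<nu> * (geo_mean a b (of_int \<lfloor>2 ^ n * \<nu>\<rfloor> / 2 ^ n)
                           - geo_mean a b ((of_int \<lfloor>2 ^ n * \<nu>\<rfloor> + 1) / 2 ^ n))\<^sup>2)"
proof (induction N)
  case (Suc N)
  then show ?case
    using dyadic_interp_geo_mean_Suc[of N \<nu>] by simp
qed simp

end

theorem theorem2p5:
  fixes a b \<nu> :: real and N :: nat
  assumes "a > 0" and "b > 0" and "0 \<le> \<nu>" and "\<nu> \<le> 1" and "N \<ge> 2"
  shows "(a powr \<nu> * b powr (1 - \<nu>))\<^sup>2 + (s_coeff 1 \<nu>)\<^sup>2 * (a - b)\<^sup>2
      + (\<Sum>j = 2..N. s_coeff j \<nu> *
          (root (2 ^ (j - 1)) (b powi (2 ^ (j - 1) - k_idx j \<nu>) * a powi (k_idx j \<nu>))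
           - root (2 ^ (j - 1)) (a powi (k_idx j \<nu> + 1) * b powi (2 ^ (j - 1) - k_idx j \<nu> - 1)))\<^sup>2)
    \<le> (\<nu> * a + (1 - \<nu>) * b)\<^sup>2"
proof -
  define g where "g = geo_mean a b"
  define T where "T n = s_coeff (Suc n) \<nu> * (g (of_int \<lfloor>2 ^ n * \<nu>\<rfloor> / 2 ^ n)
                           - g ((of_int \<lfloor>2 ^ n * \<nu>\<rfloor> + 1) / 2 ^ n))\<^sup>2" for n
  define S where "S = (\<Sum>j = 2..N. s_coeff j \<nu> *
          (root (2 ^ (j - 1)) (b powi (2 ^ (j - 1) - k_idx j \<nu>) * a powi (k_idx j \<nu>))
           - root (2 ^ (j - 1)) (a powi (k_idx j \<nu> + 1) * b powi (2 ^ (j - 1) - k_idx j \<nu> - 1)))\<^sup>2)"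
  have summand: "s_coeff (Suc n) \<nu> *
          (root (2 ^ n) (b powi (2 ^ n - k_idx (Suc n) \<nu>) * a powi (k_idx (Suc n) \<nu>))
           - root (2 ^ n) (a powi (k_idx (Suc n) \<nu> + 1) * b powi (2 ^ n - k_idx (Suc n) \<nu> - 1)))\<^sup>2
       = T n" for n
    using root_powi_eq_geo_mean[OF assms(1,2), of "2 ^ n" "2 ^ n - \<lfloor>2 ^ n * \<nu>\<rfloor>" "\<lfloor>2 ^ n * \<nu>\<rfloor>"]
      root_powi_eq_geo_mean[OF assms(1,2), of "2 ^ n" "2 ^ n - \<lfloor>2 ^ n * \<nu>\<rfloor> - 1" "\<lfloor>2 ^ n * \<nu>\<rfloor> + 1"]
    by (simp add: T_def g_def k_idx_def mult.commute)
  \<comment> \<open>The index shift is \<open>j = n + 1\<close>. \<open>T 0\<close> stays outside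
    \<open>S\<close>, since the first coefficient enters the theorem squared.\<close>
  have "S = (\<Sum>n = 1..<N. T n)"
    unfolding S_def
    by (rule sum.reindex_bij_witness[of _ Suc "\<lambda>j. j - 1"]) (auto simp flip: summand)
  moreover have "(\<Sum>n<N. T n) = T 0 + (\<Sum>n = 1..<N. T n)"
    using assms(5) by (simp add: lessThan_atLeast0 sum.atLeast_Suc_lessThan)
  moreover have "(g \<nu>)\<^sup>2 + (\<Sum>n<N. T n) \<le> dyadic_interp (\<lambda>t. (g t)\<^sup>2) 0 \<nu>"
    using geo_mean_le_dyadic_interp[OF assms(1,2), of \<nu> N]
      dyadic_interp_geo_mean_telescope[OF assms(1,2), of \<nu> N]
    by (simp add: T_def g_def)
  moreover have "dyadic_interp (\<lambda>t. (g t)\<^sup>2) 0 \<nu> - T 0 + (s_coeff 1 \<nu>)\<^sup>2 * (a - b)\<^sup>2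
      = (\<nu> * a + (1 - \<nu>) * b)\<^sup>2"
  proof -
    define s where "s = s_coeff 1 \<nu>"
    have g01: "g 0 = b" "g 1 = a"
      using assms(1,2) by (simp_all add: g_def geo_mean_def)
    have "dyadic_interp (\<lambda>t. (g t)\<^sup>2) 0 \<nu> = (1 - \<nu>) * b\<^sup>2 + \<nu> * a\<^sup>2
        \<and> T 0 = s * (a - b)\<^sup>2 \<and> s * (1 - s) = \<nu> * (1 - \<nu>)"
    \<comment> \<open>At \<open>\<nu> = 1\<close> the floor jumps to 1, but \<open>s = 0\<close>
      makes \<open>T 0\<close> vanish. Otherwise the cell is [0, 1] and \<open>s\<close> is
      \<open>\<nu>\<close> or \<open>1 - \<nu>\<close>.\<close>
    proof (cases "\<nu> = 1")
      case True
      then show ?thesis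
        using s_coeff_Suc[of 0 \<nu>] by (simp add: dyadic_interp_def T_def s_def g01)
    next
      case False
      then have "\<lfloor>\<nu>\<rfloor> = 0" "frac \<nu> = \<nu>"
        using assms(3,4) by (simp_all add: floor_eq_iff frac_eq)
      then show ?thesis
        using s_coeff_Suc[of 0 \<nu>]
        by (auto simp: dyadic_interp_def T_def s_def g01 min_def power2_commute)
    qed
    then have L0: "dyadic_interp (\<lambda>t. (g t)\<^sup>2) 0 \<nu> = (1 - \<nu>) * b\<^sup>2 + \<nu> * a\<^sup>2"
      and T0: "T 0 = s * (a - b)\<^sup>2" and s: "s * (1 - s) = \<nu> * (1 - \<nu>)"
      by auto
    have "dyadic_interp (\<lambda>t. (g t)\<^sup>2) 0 \<nu> - T 0 + s\<^sup>2 * (a - b)\<^sup>2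
        = (1 - \<nu>) * b\<^sup>2 + \<nu> * a\<^sup>2 - s * (1 - s) * (a - b)\<^sup>2"
      unfolding L0 T0 by (simp add: power2_eq_square algebra_simps)
    also have "\<dots> = (1 - \<nu>) * b\<^sup>2 + \<nu> * a\<^sup>2 - \<nu> * (1 - \<nu>) * (a - b)\<^sup>2"
      unfolding s ..
    also have "\<dots> = (\<nu> * a + (1 - \<nu>) * b)\<^sup>2"
      by (simp add: power2_eq_square algebra_simps)
    finally show ?thesis by (simp add: s_def)
  qed
  ultimately have "(g \<nu>)\<^sup>2 + (s_coeff 1 \<nu>)\<^sup>2 * (a - b)\<^sup>2 + S \<le> (\<nu> * a + (1 - \<nu>) * b)\<^sup>2"
    by linarith
  then show ?thesis
    unfolding g_def geo_mean_def S_def .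
qed

end
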